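(* Let $Q,R,S\in\mathfrak{P}$ and let $\rho$ be a strong G-scheme from $Q\times R$ to $Q\times S$ such that for all $P\in\mathfrak{P}_r$, $\xi,\zeta\in\mathcal{H}(P,Q)$, $\theta\in\mathcal{H}(P,R)$: $\xi\ne\zeta$ implies $\rho_P(\xi,\theta)_1\ne\rho_P(\zeta,\theta)_1$. Fix $q\in Q$. For $P\in\mathfrak{P}_r$ and $\xi\in\mathcal{H}(P,R)$ define recursively $\phi_P^0(\xi):=c_{P,q}$ and $\phi_P^i(\xi):=\rho_P(\phi_P^{i-1}(\xi),\xi)_1$ for $i\in\mathbb{N}$, and put $\Phi_P^i(\xi):=(\phi_P^i(\xi),\xi)\in\mathcal{H}(P,Q\times R)$. Then for every $P\in\mathfrak{P}_r$ and $\xi\in\mathcal{H}(P,R)$ there exists $n_P(\xi)\in\mathbb{N}$ with $\phi_P^{n_P(\xi)}(\xi)=c_{P,q}$, and, for any such choice of $n_P(\xi)$, the family $\tau=(\tau_P)_{P\in\mathfrak{P}_r}$ given by $\tau_P(\xi):=\rho_P(\Phi_P^{n_P(\xi)-1}(\xi))_2$ is a strong G-scheme from $R$ to $S$. In particular $R\sqsubseteq_G S$.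
   Context: $\mathfrak{P}$ is the class of finite nonempty posets and $\mathfrak{P}_r$ a fixed system of representatives of its isomorphism classes; $\mathbb{N}=\{1,2,\dots\}$. $\mathcal{H}(P,Q)$ is the set of order-preserving maps $P\to Q$. $Q\times R$ is the product poset (componentwise order). For $\xi\in\mathcal{H}(P,Q)$, $\theta\in\mathcal{H}(P,R)$, $(\xi,\theta)\in\mathcal{H}(P,Q\times R)$ is $x\mapsto(\xi(x),\theta(x))$; for $\mu\in\mathcal{H}(P,Q\times S)$, $\mu_1\in\mathcal{H}(P,Q)$ and $\mu_2\in\mathcal{H}(P,S)$ denote its components. $c_{P,q}\in\mathcal{H}(P,Q)$ is the constant map with value $q$. For $A\subseteq P$, $x\in A$: $\gamma_A(x)$ is the set of $y\in A$ joined to $x$ by a sequence $x=z_0,\dots,z_L=y$ in $A$ ($L\ge0$) with consecutive elements strictly comparable; for a map $\xi$ on $P$, $G_\xi(x):=\gamma_{\xi^{-1}(\xi(x))}(x)$. A Hom-scheme from $A$ to $B$ is a family $(\rho_P)_{P\in\mathfrak{P}_r}$ of maps $\rho_P:\mathcal{H}(P,A)\to\mathcal{H}(P,B)$; it is strong if every $\rho_P$ is injective, and a G-scheme if $G_{\rho_P(\xi)}(x)=G_\xi(x)$ for all $P\in\mathfrak{P}_r$, $\xi\in\mathcal{H}(P,A)$, $x\in P$. $R\sqsubseteq_G S$ means a strong G-scheme from $R$ to $S$ exists. *)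

theory Defs
  imports Main "HOL-Library.FuncSet"
begin

text \<open>
  A poset is given by its (reflexive) order relation; its carrier is the field of the relation.
\<close>

definition finite_poset :: "'a rel \<Rightarrow> bool" where
  "finite_poset P \<longleftrightarrow> Partial_order P \<and> finite (Field P) \<and> Field P \<noteq> {}"

definition poset_iso :: "'a rel \<Rightarrow> 'b rel \<Rightarrow> bool" where
  "poset_iso P Q \<longleftrightarrow> (\<exists>f. bij_betw f (Field P) (Field Q) \<and>
     (\<forall>x\<in>Field P. \<forall>y\<in>Field P. (x, y) \<in> P \<longleftrightarrow> (f x, f y) \<in> Q))"

text \<open>
  The representatives may live on an arbitrary type. Since one cannot quantify over types inside
  a formula, completeness is required for posets on \<open>nat\<close>; this covers the finite posets
  on all types, see \<open>representative_system_complete\<close> below.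
\<close>

definition representative_system :: "'p rel set \<Rightarrow> bool" where
  "representative_system Prs \<longleftrightarrow>
     (\<forall>P\<in>Prs. finite_poset P) \<and>
     (\<forall>P\<in>Prs. \<forall>P'\<in>Prs. poset_iso P P' \<longrightarrow> P = P') \<and>
     (\<forall>N :: nat rel. finite_poset N \<longrightarrow> (\<exists>P\<in>Prs. poset_iso N P))"

lemma poset_iso_trans:
  assumes "poset_iso P Q" and "poset_iso Q R"
  shows "poset_iso P R"
proof -
  obtain f where f: "bij_betw f (Field P) (Field Q)"
    "\<forall>x\<in>Field P. \<forall>y\<in>Field P. (x, y) \<in> P \<longleftrightarrow> (f x, f y) \<in> Q"
    using assms(1) unfolding poset_iso_def by blast
  obtain g where g: "bij_betw g (Field Q) (Field R)"
    "\<forall>x\<in>Field Q. \<forall>y\<in>Field Q. (x, y) \<in> Q \<longleftrightarrow> (g x, g y) \<in> R"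
    using assms(2) unfolding poset_iso_def by blast
  have "bij_betw (g \<circ> f) (Field P) (Field R)"
    using f(1) g(1) by (rule bij_betw_trans)
  moreover have "(x, y) \<in> P \<longleftrightarrow> ((g \<circ> f) x, (g \<circ> f) y) \<in> R"
    if "x \<in> Field P" "y \<in> Field P" for x y
    using that f g bij_betwE[OF f(1)] by auto
  ultimately show ?thesis
    unfolding poset_iso_def by blast
qed

lemma representative_system_complete:
  fixes X :: "'x rel"
  assumes "representative_system Prs" and "finite_poset X"
  shows "\<exists>P\<in>Prs. poset_iso X P"
proof -
  have po: "Partial_order X" and fin: "finite (Field X)" and ne: "Field X \<noteq> {}"
    using assms(2) by (auto simp: finite_poset_def)
  obtain f :: "'x \<Rightarrow> nat" where inj: "inj_on f (Field X)"
    using finite_imp_inj_to_nat_seg[OF fin] by blast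
  define N where "N = map_prod f f ` X"
  have fld: "Field N = f ` Field X"
    unfolding N_def Field_def by force
  have iff: "(f x, f y) \<in> N \<longleftrightarrow> (x, y) \<in> X" if "x \<in> Field X" "y \<in> Field X" for x y
  proof
    assume "(f x, f y) \<in> N"
    then obtain u v where "(u, v) \<in> X" "f x = f u" "f y = f v"
      unfolding N_def by auto
    moreover from this have "u \<in> Field X" "v \<in> Field X"
      by (auto simp: Field_def)
    ultimately show "(x, y) \<in> X"
      using inj that by (auto dest: inj_onD)
  next
    assume "(x, y) \<in> X"
    then show "(f x, f y) \<in> N"
      unfolding N_def by force
  qed
  have rfl: "(x, x) \<in> X" if "x \<in> Field X" for x
    using po that by (auto simp: order_on_defs refl_on_def)
  have sub: "N \<subseteq> Field N \<times> Field N"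
    by (auto simp: Field_def)
  have "Refl N"
    using sub rfl iff unfolding refl_on_def fld by auto
  moreover have "trans N"
  proof (rule transI)
    fix a b c assume ab: "(a, b) \<in> N" and bc: "(b, c) \<in> N"
    then obtain x y z where "x \<in> Field X" "y \<in> Field X" "z \<in> Field X"
      "a = f x" "b = f y" "c = f z"
      using sub fld by (smt (verit) imageE mem_Sigma_iff subsetD)
    with ab bc iff show "(a, c) \<in> N"
      using po by (metis order_on_defs(1) order_on_defs(2) transD)
  qed
  moreover have "antisym N"
  proof (rule antisymI)
    fix a b assume ab: "(a, b) \<in> N" and ba: "(b, a) \<in> N"
    then obtain x y where "x \<in> Field X" "y \<in> Field X" "a = f x" "b = f y"
      using sub fld by (smt (verit) imageE mem_Sigma_iff subsetD)
    with ab ba iff show "a = b"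
      using po by (metis order_on_defs(2) antisymD)
  qed
  ultimately have "finite_poset N"
    using fin ne sub fld by (auto simp: finite_poset_def order_on_defs)
  then obtain P where P: "P \<in> Prs" "poset_iso N P"
    using assms(1) by (auto simp: representative_system_def)
  have "poset_iso X N"
    unfolding poset_iso_def using inj fld iff by (intro exI[of _ f]) (auto simp: bij_betw_def)
  with P show ?thesis
    using poset_iso_trans by blast
qed

definition poset_prod :: "'a rel \<Rightarrow> 'b rel \<Rightarrow> ('a \<times> 'b) rel" where
  "poset_prod Q R = {((a, b), (a', b')). (a, a') \<in> Q \<and> (b, b') \<in> R}"

text \<open>
  Maps on a poset are extensional functions on its carrier, so that equality of maps is equality
  in HOL. Accordingly the constructions of maps below restrict to the carrier.
\<close>

definition Homs :: "'p rel \<Rightarrow> 'a rel \<Rightarrow> ('p \<Rightarrow> 'a) set" where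
  "Homs P Q = {\<xi> \<in> Field P \<rightarrow>\<^sub>E Field Q. \<forall>x y. (x, y) \<in> P \<longrightarrow> (\<xi> x, \<xi> y) \<in> Q}"

definition pair_map :: "'p rel \<Rightarrow> ('p \<Rightarrow> 'a) \<Rightarrow> ('p \<Rightarrow> 'b) \<Rightarrow> 'p \<Rightarrow> 'a \<times> 'b" where
  "pair_map P \<xi> \<theta> = (\<lambda>x\<in>Field P. (\<xi> x, \<theta> x))"

definition comp1 :: "'p rel \<Rightarrow> ('p \<Rightarrow> 'a \<times> 'b) \<Rightarrow> 'p \<Rightarrow> 'a" where
  "comp1 P \<mu> = (\<lambda>x\<in>Field P. fst (\<mu> x))"

definition comp2 :: "'p rel \<Rightarrow> ('p \<Rightarrow> 'a \<times> 'b) \<Rightarrow> 'p \<Rightarrow> 'b" where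
  "comp2 P \<mu> = (\<lambda>x\<in>Field P. snd (\<mu> x))"

definition const_map :: "'p rel \<Rightarrow> 'a \<Rightarrow> 'p \<Rightarrow> 'a" where
  "const_map P q = (\<lambda>x\<in>Field P. q)"

definition strictly_comparable_in :: "'p rel \<Rightarrow> 'p set \<Rightarrow> 'p rel" where
  "strictly_comparable_in P A =
     {(u, v). u \<in> A \<and> v \<in> A \<and> u \<noteq> v \<and> ((u, v) \<in> P \<or> (v, u) \<in> P)}"

text \<open>Only meant for \<open>A \<subseteq> Field P\<close> and \<open>x \<in> A\<close>.\<close>

definition gamma :: "'p rel \<Rightarrow> 'p set \<Rightarrow> 'p \<Rightarrow> 'p set" where
  "gamma P A x = {y. (x, y) \<in> (strictly_comparable_in P A)\<^sup>*}"

definition G_set :: "'p rel \<Rightarrow> ('p \<Rightarrow> 'a) \<Rightarrow> 'p \<Rightarrow> 'p set" where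
  "G_set P \<xi> x = gamma P {y \<in> Field P. \<xi> y = \<xi> x} x"

definition hom_scheme ::
    "'p rel set \<Rightarrow> 'a rel \<Rightarrow> 'b rel \<Rightarrow> ('p rel \<Rightarrow> ('p \<Rightarrow> 'a) \<Rightarrow> 'p \<Rightarrow> 'b) \<Rightarrow> bool" where
  "hom_scheme Prs A B \<rho> \<longleftrightarrow> (\<forall>P\<in>Prs. \<rho> P \<in> Homs P A \<rightarrow> Homs P B)"

definition strong_hom_scheme ::
    "'p rel set \<Rightarrow> 'a rel \<Rightarrow> 'b rel \<Rightarrow> ('p rel \<Rightarrow> ('p \<Rightarrow> 'a) \<Rightarrow> 'p \<Rightarrow> 'b) \<Rightarrow> bool" where
  "strong_hom_scheme Prs A B \<rho> \<longleftrightarrow>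
     hom_scheme Prs A B \<rho> \<and> (\<forall>P\<in>Prs. inj_on (\<rho> P) (Homs P A))"

definition G_scheme ::
    "'p rel set \<Rightarrow> 'a rel \<Rightarrow> 'b rel \<Rightarrow> ('p rel \<Rightarrow> ('p \<Rightarrow> 'a) \<Rightarrow> 'p \<Rightarrow> 'b) \<Rightarrow> bool" where
  "G_scheme Prs A B \<rho> \<longleftrightarrow>
     hom_scheme Prs A B \<rho> \<and>
     (\<forall>P\<in>Prs. \<forall>\<xi>\<in>Homs P A. \<forall>x\<in>Field P. G_set P (\<rho> P \<xi>) x = G_set P \<xi> x)"

definition strong_G_scheme ::
    "'p rel set \<Rightarrow> 'a rel \<Rightarrow> 'b rel \<Rightarrow> ('p rel \<Rightarrow> ('p \<Rightarrow> 'a) \<Rightarrow> 'p \<Rightarrow> 'b) \<Rightarrow> bool" where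
  "strong_G_scheme Prs A B \<rho> \<longleftrightarrow> strong_hom_scheme Prs A B \<rho> \<and> G_scheme Prs A B \<rho>"

definition G_below :: "'p rel set \<Rightarrow> 'a rel \<Rightarrow> 'b rel \<Rightarrow> bool" where
  "G_below Prs R S \<longleftrightarrow> (\<exists>\<rho>. strong_G_scheme Prs R S \<rho>)"

primrec phi :: "('p rel \<Rightarrow> ('p \<Rightarrow> 'a \<times> 'b) \<Rightarrow> 'p \<Rightarrow> 'a \<times> 'c) \<Rightarrow> 'a \<Rightarrow> 'p rel \<Rightarrow> ('p \<Rightarrow> 'b) \<Rightarrow>
    nat \<Rightarrow> 'p \<Rightarrow> 'a" where
  "phi \<rho> q P \<xi> 0 = const_map P q"
| "phi \<rho> q P \<xi> (Suc i) = comp1 P (\<rho> P (pair_map P (phi \<rho> q P \<xi> i) \<xi>))"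

definition Phi :: "('p rel \<Rightarrow> ('p \<Rightarrow> 'a \<times> 'b) \<Rightarrow> 'p \<Rightarrow> 'a \<times> 'c) \<Rightarrow> 'a \<Rightarrow> 'p rel \<Rightarrow> ('p \<Rightarrow> 'b) \<Rightarrow>
    nat \<Rightarrow> 'p \<Rightarrow> 'a \<times> 'b" where
  "Phi \<rho> q P \<xi> i = pair_map P (phi \<rho> q P \<xi> i) \<xi>"

end

theory Submission imports Defs begin

text \<open>
  For fixed \<open>\<xi>\<close>, the map \<open>\<alpha> \<mapsto> \<rho>\<^sub>P(\<alpha>, \<xi>)\<^sub>1\<close> is a permutation of the finite set \<open>H(P, Q)\<close>, so the
  orbit of the constant map \<open>c\<close> returns to it. At the last step before the return, \<open>\<rho>\<^sub>P\<close> takes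
  the value \<open>(c, \<tau>\<^sub>P(\<xi>))\<close>; hence \<open>\<tau>\<^sub>P(\<xi>)\<close> determines the argument and with it \<open>\<xi>\<close>. Along the
  orbit, the first component remains constant on the sets \<open>G\<^sub>\<xi>(x)\<close>, because \<open>\<rho>\<close> preserves
  connectivity components; so pairing it with \<open>\<xi>\<close> does not change these sets.
\<close>

lemma finite_inj_on_returns:
  assumes "finite A" and "f \<in> A \<rightarrow> A" and "inj_on f A" and "a \<in> A"
  shows "\<exists>n\<ge>1. (f ^^ n) a = a"
proof -
  \<comment> \<open>\<open>funpow_inj_finite\<close> asks for injectivity on the whole type, so
    \<open>f\<close> is extended by the identity outside \<open>A\<close>; the orbit of
    \<open>a\<close> stays in \<open>A\<close>, where both maps agree.\<close>
  define g where "g x = (if x \<in> A then f x else x)" for x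
  have "inj g"
    using assms(2,3) by (auto simp: g_def inj_def inj_on_def Pi_iff split: if_splits)
  have g: "(g ^^ n) a = (f ^^ n) a \<and> (f ^^ n) a \<in> A" for n
    using assms(2,4) by (induction n) (auto simp: g_def)
  have "finite {y. \<exists>n. y = (g ^^ n) a}"
    by (rule finite_subset[OF _ assms(1)]) (use g in auto)
  then obtain n where "n > 0" "(g ^^ n) a = a"
    using funpow_inj_finite[OF \<open>inj g\<close>] by blast
  then show ?thesis
    using g by (intro exI[of _ n]) auto
qed

lemma finite_Homs:
  assumes "finite_poset P" and "finite_poset Q"
  shows "finite (Homs P Q)"
proof (rule finite_subset)
  show "Homs P Q \<subseteq> Field P \<rightarrow>\<^sub>E Field Q"
    by (auto simp: Homs_def)
  show "finite (Field P \<rightarrow>\<^sub>E Field Q)"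
    using assms by (intro finite_PiE) (auto simp: finite_poset_def)
qed

text \<open>Reflexivity is what gives the inclusion from right to left: each pair of carrier points
  is related to itself. For arbitrary relations, a pair of a minimal and a maximal point could be
  related to nothing.\<close>

lemma Field_poset_prod:
  assumes "finite_poset Q" and "finite_poset R"
  shows "Field (poset_prod Q R) = Field Q \<times> Field R"
proof -
  have "(a, a) \<in> Q" if "a \<in> Field Q" for a
    using assms(1) that by (auto simp: finite_poset_def order_on_defs refl_on_def)
  moreover have "(b, b) \<in> R" if "b \<in> Field R" for b
    using assms(2) that by (auto simp: finite_poset_def order_on_defs refl_on_def)
  ultimately show ?thesis
    by (auto simp: poset_prod_def Field_def Domain_iff Range_iff) blast+
qed

lemma const_map_in_Homs:
  assumes "finite_poset Q" and "q \<in> Field Q"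
  shows "const_map P q \<in> Homs P Q"
  using assms
  by (auto simp: Homs_def const_map_def finite_poset_def order_on_defs refl_on_def Field_def)

lemma pair_map_in_Homs:
  assumes "finite_poset Q" and "finite_poset R" and "\<xi> \<in> Homs P Q" and "\<theta> \<in> Homs P R"
  shows "pair_map P \<xi> \<theta> \<in> Homs P (poset_prod Q R)"
  using assms(3,4) unfolding Homs_def Field_poset_prod[OF assms(1,2)]
  by (auto simp: pair_map_def poset_prod_def FieldI1 FieldI2)

lemma comp1_in_Homs:
  assumes "finite_poset Q" and "finite_poset R" and "\<mu> \<in> Homs P (poset_prod Q R)"
  shows "comp1 P \<mu> \<in> Homs P Q"
  using assms(3) unfolding Homs_def Field_poset_prod[OF assms(1,2)]
  by (auto 4 3 simp: comp1_def poset_prod_def FieldI1 FieldI2 PiE_iff mem_Times_iff split_beta)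

lemma comp2_in_Homs:
  assumes "finite_poset Q" and "finite_poset R" and "\<mu> \<in> Homs P (poset_prod Q R)"
  shows "comp2 P \<mu> \<in> Homs P R"
  using assms(3) unfolding Homs_def Field_poset_prod[OF assms(1,2)]
  by (auto 4 3 simp: comp2_def poset_prod_def FieldI1 FieldI2 PiE_iff mem_Times_iff split_beta)

text \<open>Off the carrier both sides are \<open>undefined\<close>, since members of
  \<open>Homs\<close> are extensional.\<close>

lemma pair_map_comp:
  assumes "\<mu> \<in> Homs P A"
  shows "pair_map P (comp1 P \<mu>) (comp2 P \<mu>) = \<mu>"
  using assms by (auto simp: Homs_def pair_map_def comp1_def comp2_def PiE_def extensional_def)

lemma pair_map_eqD2:
  assumes "pair_map P \<alpha> \<xi> = pair_map P \<beta> \<zeta>" and "\<xi> \<in> Homs P R" and "\<zeta> \<in> Homs P R"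
  shows "\<xi> = \<zeta>"
proof (rule PiE_ext)
  show "\<xi> \<in> Field P \<rightarrow>\<^sub>E Field R" "\<zeta> \<in> Field P \<rightarrow>\<^sub>E Field R"
    using assms(2,3) by (auto simp: Homs_def)
  show "\<xi> x = \<zeta> x" if "x \<in> Field P" for x
    using fun_cong[OF assms(1), of x] that by (simp add: pair_map_def)
qed

text \<open>Every point that a path reaches lies in the level set of \<open>x\<close>; for the path
  of length 0 this rests on \<open>x\<close> being in the carrier.\<close>

lemma G_setD:
  assumes "y \<in> G_set P \<xi> x" and "x \<in> Field P"
  shows "y \<in> Field P" and "\<xi> y = \<xi> x"
proof -
  have "y \<in> Field P \<and> \<xi> y = \<xi> x"
    using assms(1) unfolding G_set_def gamma_def mem_Collect_eq
    by (induction rule: rtrancl_induct) (use assms(2) in \<open>auto simp: strictly_comparable_in_def\<close>)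
  then show "y \<in> Field P" and "\<xi> y = \<xi> x"
    by auto
qed

text \<open>A path from \<open>x\<close> in its level set under \<xi> runs entirely through
  \<open>G_set P \<xi> x\<close>. Constancy of \<eta> on this component, not on the whole level set,
  thus makes it a path in the level set under \<eta>.\<close>

lemma G_set_subset:
  assumes "\<And>y. y \<in> G_set P \<xi> x \<Longrightarrow> \<eta> y = \<eta> x"
  shows "G_set P \<xi> x \<subseteq> G_set P \<eta> x"
proof
  fix y assume "y \<in> G_set P \<xi> x"
  then have "(x, y) \<in> (strictly_comparable_in P {y \<in> Field P. \<xi> y = \<xi> x})\<^sup>*"
    by (simp add: G_set_def gamma_def)
  then show "y \<in> G_set P \<eta> x"
  proof (induction rule: rtrancl_induct)
    case base
    show ?case by (simp add: G_set_def gamma_def)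
  next
    case (step y z)
    have "\<eta> y = \<eta> x" "\<eta> z = \<eta> x"
      using step.hyps by (auto intro!: assms simp: G_set_def gamma_def)
    with step.hyps(2) have "(y, z) \<in> strictly_comparable_in P {y \<in> Field P. \<eta> y = \<eta> x}"
      by (auto simp: strictly_comparable_in_def)
    with step.IH show ?case
      by (auto simp: G_set_def gamma_def)
  qed
qed

text \<open>Pairing refines the level sets and could split components; a first component that is
  constant on the component of \<open>x\<close> leaves that one intact.\<close>

lemma G_set_pair_map:
  assumes "x \<in> Field P" and "\<And>y. y \<in> G_set P \<xi> x \<Longrightarrow> \<alpha> y = \<alpha> x"
  shows "G_set P (pair_map P \<alpha> \<xi>) x = G_set P \<xi> x"
proof (rule equalityI; rule G_set_subset)
  fix y assume "y \<in> G_set P (pair_map P \<alpha> \<xi>) x"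
  from G_setD[OF this assms(1)] show "\<xi> y = \<xi> x"
    using assms(1) by (simp add: pair_map_def)
next
  fix y assume "y \<in> G_set P \<xi> x"
  with G_setD[OF this assms(1)] assms show "pair_map P \<alpha> \<xi> y = pair_map P \<alpha> \<xi> x"
    by (simp add: pair_map_def)
qed

theorem theorem8:
  fixes Prs :: "'p rel set"
    and Q :: "'a rel" and R :: "'b rel" and S :: "'c rel"
    and \<rho> :: "'p rel \<Rightarrow> ('p \<Rightarrow> 'a \<times> 'b) \<Rightarrow> 'p \<Rightarrow> 'a \<times> 'c"
    and q :: 'a
  assumes "representative_system Prs"
    and "finite_poset Q" and "finite_poset R" and "finite_poset S"
    and "strong_G_scheme Prs (poset_prod Q R) (poset_prod Q S) \<rho>"
    and "\<And>P \<xi> \<zeta> \<theta>. P \<in> Prs \<Longrightarrow> \<xi> \<in> Homs P Q \<Longrightarrow> \<zeta> \<in> Homs P Q \<Longrightarrow> \<theta> \<in> Homs P R \<Longrightarrow> \<xi> \<noteq> \<zeta> \<Longrightarrow>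
           comp1 P (\<rho> P (pair_map P \<xi> \<theta>)) \<noteq> comp1 P (\<rho> P (pair_map P \<zeta> \<theta>))"
    and "q \<in> Field Q"
  shows "(\<forall>P\<in>Prs. \<forall>\<xi>\<in>Homs P R. \<exists>n\<ge>1. phi \<rho> q P \<xi> n = const_map P q) \<and>
    (\<forall>n :: 'p rel \<Rightarrow> ('p \<Rightarrow> 'b) \<Rightarrow> nat.
       (\<forall>P\<in>Prs. \<forall>\<xi>\<in>Homs P R. n P \<xi> \<ge> 1 \<and> phi \<rho> q P \<xi> (n P \<xi>) = const_map P q) \<longrightarrow>
       strong_G_scheme Prs R S (\<lambda>P \<xi>. comp2 P (\<rho> P (Phi \<rho> q P \<xi> (n P \<xi> - 1))))) \<and>
    G_below Prs R S"
proof -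
  have Rho: "\<rho> P \<mu> \<in> Homs P (poset_prod Q S)"
    if "P \<in> Prs" "\<mu> \<in> Homs P (poset_prod Q R)" for P \<mu>
    using assms(5) that by (auto simp: strong_G_scheme_def G_scheme_def hom_scheme_def)
  have Rho_inj: "inj_on (\<rho> P) (Homs P (poset_prod Q R))" if "P \<in> Prs" for P
    using assms(5) that by (auto simp: strong_G_scheme_def strong_hom_scheme_def)
  have Rho_G: "G_set P (\<rho> P \<mu>) x = G_set P \<mu> x"
    if "P \<in> Prs" "\<mu> \<in> Homs P (poset_prod Q R)" "x \<in> Field P" for P \<mu> x
    using assms(5) that by (auto simp: strong_G_scheme_def G_scheme_def)
  have phi_in: "phi \<rho> q P \<xi> i \<in> Homs P Q" if "P \<in> Prs" "\<xi> \<in> Homs P R" for P \<xi> i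
    using that assms(2-4,7)
    by (induction i) (auto intro!: const_map_in_Homs comp1_in_Homs Rho pair_map_in_Homs)
  have Phi_in: "Phi \<rho> q P \<xi> i \<in> Homs P (poset_prod Q R)" if "P \<in> Prs" "\<xi> \<in> Homs P R" for P \<xi> i
    unfolding Phi_def using that assms(2,3) phi_in by (intro pair_map_in_Homs)
  have phi_const: "phi \<rho> q P \<xi> i y = phi \<rho> q P \<xi> i x"
    if "P \<in> Prs" "\<xi> \<in> Homs P R" "x \<in> Field P" "y \<in> G_set P \<xi> x" for P \<xi> i x y
    using that(4)
  \<comment> \<open>The point \<open>y\<close> is generalized because \<open>G_set_pair_map\<close>
    needs the induction hypothesis on the whole component. Then \<rho> carries this component over
    to the image, whose first component is the next member of the orbit.\<close>
  proof (induction i arbitrary: y)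
    case 0
    then show ?case
      using G_setD[OF 0 that(3)] that(3) by (simp add: const_map_def)
  next
    case (Suc i)
    have "G_set P (\<rho> P (Phi \<rho> q P \<xi> i)) x = G_set P (Phi \<rho> q P \<xi> i) x"
      using that(1-3) by (intro Rho_G Phi_in)
    also have "\<dots> = G_set P \<xi> x"
      unfolding Phi_def using that(3) Suc.IH by (rule G_set_pair_map)
    finally have "y \<in> G_set P (\<rho> P (Phi \<rho> q P \<xi> i)) x"
      using Suc.prems by simp
    from G_setD[OF this that(3)] show ?case
      using that(3) by (simp add: Phi_def comp1_def)
  qed
  have returns: "\<exists>n\<ge>1. phi \<rho> q P \<xi> n = const_map P q" if P: "P \<in> Prs" and \<xi>: "\<xi> \<in> Homs P R" for P \<xi>
  proof -
    \<comment> \<open>One step of the recursion with \<xi> held fixed, so that \<open>phi\<close>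
      lists the orbit of the constant map under \<open>f\<close>.\<close>
    define f where "f \<alpha> = comp1 P (\<rho> P (pair_map P \<alpha> \<xi>))" for \<alpha>
    have "phi \<rho> q P \<xi> i = (f ^^ i) (const_map P q)" for i
      by (induction i) (auto simp: f_def)
    moreover have "\<exists>n\<ge>1. (f ^^ n) (const_map P q) = const_map P q"
    proof (rule finite_inj_on_returns)
      show "finite (Homs P Q)"
        using assms(1,2) P by (intro finite_Homs) (auto simp: representative_system_def)
      show "f \<in> Homs P Q \<rightarrow> Homs P Q"
        unfolding f_def using P \<xi> assms(2-4)
        by (auto intro!: comp1_in_Homs Rho pair_map_in_Homs)
      \<comment> \<open>This is the separation hypothesis on \<rho> with \<theta> taken to be
        \<xi>.\<close>
      show "inj_on f (Homs P Q)"
        unfolding f_def using assms(6)[OF P _ _ \<xi>] by (meson inj_onI)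
      show "const_map P q \<in> Homs P Q"
        using assms(2,7) by (rule const_map_in_Homs)
    qed
    ultimately show ?thesis
      by simp
  qed
  have strong: "strong_G_scheme Prs R S (\<lambda>P \<xi>. comp2 P (\<rho> P (Phi \<rho> q P \<xi> (n P \<xi> - 1))))"
    if n: "\<And>P \<xi>. P \<in> Prs \<Longrightarrow> \<xi> \<in> Homs P R \<Longrightarrow> n P \<xi> \<ge> 1 \<and> phi \<rho> q P \<xi> (n P \<xi>) = const_map P q"
    for n :: "'p rel \<Rightarrow> ('p \<Rightarrow> 'b) \<Rightarrow> nat"
  proof -
    define \<tau> where "\<tau> P \<xi> = comp2 P (\<rho> P (Phi \<rho> q P \<xi> (n P \<xi> - 1)))" for P \<xi>
    have \<tau>_in: "\<tau> P \<xi> \<in> Homs P S" if "P \<in> Prs" "\<xi> \<in> Homs P R" for P \<xi>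
      unfolding \<tau>_def using that by (intro comp2_in_Homs[OF assms(2,4)] Rho Phi_in)
    have last_step: "\<rho> P (Phi \<rho> q P \<xi> (n P \<xi> - 1)) = pair_map P (const_map P q) (\<tau> P \<xi>)"
      if P: "P \<in> Prs" and \<xi>: "\<xi> \<in> Homs P R" for P \<xi>
    proof -
      \<comment> \<open>Since \<open>n P \<xi>\<close> is at least 1, the truncated subtraction
        yields a true predecessor, and applying \<rho> at that index computes \<open>phi\<close> at
        index \<open>n P \<xi>\<close>.\<close>
      obtain m where "n P \<xi> = Suc m"
        using n[OF P \<xi>] by (cases "n P \<xi>") auto
      then have "comp1 P (\<rho> P (Phi \<rho> q P \<xi> (n P \<xi> - 1))) = const_map P q"
        using n[OF P \<xi>] by (simp add: Phi_def)
      then show ?thesis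
        using pair_map_comp[OF Rho[OF P Phi_in[OF P \<xi>]]] by (metis \<tau>_def)
    qed
    have "inj_on (\<tau> P) (Homs P R)" if P: "P \<in> Prs" for P
    proof (rule inj_onI)
      fix \<xi> \<zeta> assume \<xi>: "\<xi> \<in> Homs P R" and \<zeta>: "\<zeta> \<in> Homs P R" and "\<tau> P \<xi> = \<tau> P \<zeta>"
      then have "\<rho> P (Phi \<rho> q P \<xi> (n P \<xi> - 1)) = \<rho> P (Phi \<rho> q P \<zeta> (n P \<zeta> - 1))"
        using last_step P by simp
      then have "Phi \<rho> q P \<xi> (n P \<xi> - 1) = Phi \<rho> q P \<zeta> (n P \<zeta> - 1)"
        using Rho_inj[OF P] Phi_in[OF P \<xi>] Phi_in[OF P \<zeta>] by (auto dest: inj_onD)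
      \<comment> \<open>The return indices of \<xi> and \<zeta> may differ, but the second component
        of \<open>Phi\<close> is the original map at every index.\<close>
      then show "\<xi> = \<zeta>"
        unfolding Phi_def using \<xi> \<zeta> by (rule pair_map_eqD2)
    qed
    moreover have "G_set P (\<tau> P \<xi>) x = G_set P \<xi> x"
      if P: "P \<in> Prs" and \<xi>: "\<xi> \<in> Homs P R" and x: "x \<in> Field P" for P \<xi> x
    proof -
      \<comment> \<open>A constant first component never splits a component, so \<tau> may be
        replaced by the full value of \<rho>, to which the G-scheme property applies.\<close>
      have "G_set P (\<tau> P \<xi>) x = G_set P (pair_map P (const_map P q) (\<tau> P \<xi>)) x"
        using x by (intro G_set_pair_map[symmetric]) (auto simp: const_map_def dest: G_setD(1))
      also have "\<dots> = G_set P (\<rho> P (Phi \<rho> q P \<xi> (n P \<xi> - 1))) x"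
        using last_step[OF P \<xi>] by simp
      also have "\<dots> = G_set P (Phi \<rho> q P \<xi> (n P \<xi> - 1)) x"
        using P \<xi> x by (intro Rho_G Phi_in)
      also have "\<dots> = G_set P \<xi> x"
        unfolding Phi_def using x phi_const[OF P \<xi> x] by (rule G_set_pair_map)
      finally show ?thesis .
    qed
    ultimately have "strong_G_scheme Prs R S \<tau>"
      using \<tau>_in
      by (auto simp: strong_G_scheme_def strong_hom_scheme_def G_scheme_def hom_scheme_def)
    then show ?thesis
      by (simp add: \<tau>_def[abs_def])
  qed
  \<comment> \<open>Return indices are chosen for all \<open>P\<close> and \<xi> at once, which
    supplies a witness for \<open>G_below\<close>.\<close>
  obtain n where "\<And>P \<xi>. P \<in> Prs \<Longrightarrow> \<xi> \<in> Homs P R \<Longrightarrow>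
      n P \<xi> \<ge> 1 \<and> phi \<rho> q P \<xi> (n P \<xi>) = const_map P q"
    using returns by metis
  from strong[OF this] have "G_below Prs R S"
    unfolding G_below_def by blast
  then show ?thesis
    using returns strong by blast
qed

end
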